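(* Let $l\geq2$ be an integer and $U=U(P,Q)$ a $\Delta$-regular Lucas sequence such that $C_{U,l}$ is a multi-Catalan sequence. Then: (1) if $l-1$ is not prime, or $l-1$ is a prime whose rank of appearance in $U$ is not $l$, then $U$ is $l$-defective; (2) if $l-1$ is a prime greater than $3$ with $(l-1)\nmid Q$ and $\rho_U(l-1)=l$, then $U$ is $(l-1)$-defective.
   Context: For nonzero integers $P,Q$, $U=U(P,Q)$ is defined by $U_0=0$, $U_1=1$, $U_{n+2}=PU_{n+1}-QU_n$; $\Delta=P^2-4Q$. $U$ is $\Delta$-regular if $U_n\neq0$ for all $n\geq1$, $\gcd(P,Q)=1$ and $\Delta\neq0$. For a prime $p\nmid Q$, the rank $\rho_U(p)$ is the least $n\geq1$ with $p\mid U_n$ (a prime dividing $Q$ has no rank). $n!_U=U_n\cdots U_1$, $0!_U=1$, and $C_{U,l}(n)=\frac{1}{U_{n+1}^l}\cdot\frac{((l+1)n)!_U}{(n!_U)^{l+1}}$. $C_{U,l}$ is multi-Catalan if $C_{U,l}(n)\in\mathbb{Z}$ for all but finitely many $n\geq1$. For $k\geq1$, $U$ is $k$-defective if there is no prime $p\nmid\Delta Q$ with $\rho_U(p)=k$. *)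

theory Defs
  imports Complex_Main "HOL-Computational_Algebra.Primes"
begin

fun lucas_U :: "int \<Rightarrow> int \<Rightarrow> nat \<Rightarrow> int" where
  "lucas_U P Q 0 = 0"
| "lucas_U P Q (Suc 0) = 1"
| "lucas_U P Q (Suc (Suc n)) = P * lucas_U P Q (Suc n) - Q * lucas_U P Q n"

definition lucas_disc :: "int \<Rightarrow> int \<Rightarrow> int" where
  "lucas_disc P Q = P\<^sup>2 - 4 * Q"

definition disc_regular :: "int \<Rightarrow> int \<Rightarrow> bool" where
  "disc_regular P Q \<longleftrightarrow>
     (\<forall>n\<ge>1. lucas_U P Q n \<noteq> 0) \<and> coprime P Q \<and> lucas_disc P Q \<noteq> 0"

text \<open>
  Only meaningful for a prime \<open>p\<close>. The value \<open>None\<close> means that \<open>p\<close> divides \<open>Q\<close> and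
  hence has no rank. If a prime \<open>p\<close> does not divide \<open>Q\<close>, then the sequence is purely
  periodic modulo \<open>p\<close>, so the least element below exists.
\<close>

definition lucas_rank :: "int \<Rightarrow> int \<Rightarrow> nat \<Rightarrow> nat option" where
  "lucas_rank P Q p =
     (if int p dvd Q then None
      else Some (LEAST n. n \<ge> 1 \<and> int p dvd lucas_U P Q n))"

definition lucas_fact :: "int \<Rightarrow> int \<Rightarrow> nat \<Rightarrow> int" where
  "lucas_fact P Q n = (\<Prod>k=1..n. lucas_U P Q k)"

definition lucas_catalan :: "int \<Rightarrow> int \<Rightarrow> nat \<Rightarrow> nat \<Rightarrow> rat" where
  "lucas_catalan P Q l n =
     1 / of_int (lucas_U P Q (n + 1)) ^ l *
     (of_int (lucas_fact P Q ((l + 1) * n)) / of_int (lucas_fact P Q n) ^ (l + 1))"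

definition multi_catalan :: "int \<Rightarrow> int \<Rightarrow> nat \<Rightarrow> bool" where
  "multi_catalan P Q l \<longleftrightarrow> finite {n. n \<ge> 1 \<and> lucas_catalan P Q l n \<notin> \<int>}"

definition defective :: "int \<Rightarrow> int \<Rightarrow> nat \<Rightarrow> bool" where
  "defective P Q k \<longleftrightarrow>
     \<not> (\<exists>p. prime p \<and> \<not> int p dvd lucas_disc P Q * Q \<and> lucas_rank P Q p = Some k)"

end

theory Submission
  imports Defs "HOL-Number_Theory.Residues"
begin

text \<open>
  Let \<open>p\<close> be a prime not dividing \<open>Q\<close> with \<open>p\<close> dividing \<open>U\<^sub>r\<close> and \<open>r \<le> l < p\<close>. For large
  \<open>e\<close> let \<open>M\<close> be the least index with \<open>p\<^sup>e\<close> dividing \<open>U\<^sub>M\<close>. By minimality of \<open>M\<close>, the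
  valuations satisfy \<open>v(U\<^bsub>Mq+s\<^esub>) = v(U\<^sub>s)\<close> for \<open>0 < s < M\<close>, and \<open>v(U\<^bsub>Mq\<^esub>) = v(U\<^sub>M)\<close> for
  \<open>0 < q < p\<close>. For \<open>n = M - 1\<close> the product \<open>((l+1)n)!\<^sub>U\<close> consists of \<open>l\<close> full blocks of length
  \<open>M\<close> and one block cut off before the index congruent to \<open>M - r\<close>, so it has
  smaller valuation than \<open>U\<^sub>M\<^sup>l (n!\<^sub>U)\<^bsup>l+1\<^esup>\<close>. As \<open>M\<close> grows with \<open>e\<close>, the quotient is
  non-integral infinitely often.

  If moreover \<open>p\<close> does not divide the discriminant, its rank is at most \<open>p + 1\<close> and different
  from \<open>p\<close>. So rank \<open>l\<close> forces \<open>l < p\<close> or \<open>l = p + 1\<close>, and an odd prime rank \<open>l - 1 > 3\<close>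
  forces \<open>l < p\<close>.
\<close>

section \<open>Divisibility in Lucas sequences\<close>

text \<open>For \<open>m \<ge> 1\<close> the bracket is \<open>- Q * lucas_U P Q (m - 1)\<close>,
  the usual coefficient; written through \<open>Suc m\<close> it needs no predecessor and covers
  \<open>m = 0\<close>.\<close>

lemma lucas_U_add:
  "lucas_U P Q (m + n) =
     lucas_U P Q m * lucas_U P Q (Suc n)
     + (lucas_U P Q (Suc m) - P * lucas_U P Q m) * lucas_U P Q n"
proof (induction n rule: induct_nat_012)
  case (ge2 n)
  have "lucas_U P Q (m + Suc (Suc n)) =
      P * lucas_U P Q (m + Suc n) - Q * lucas_U P Q (m + n)"
    by simp
  also have "\<dots> = lucas_U P Q m * lucas_U P Q (Suc (Suc (Suc n)))
     + (lucas_U P Q (Suc m) - P * lucas_U P Q m) * lucas_U P Q (Suc (Suc n))"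
    by (simp only: ge2.IH lucas_U.simps) (simp add: algebra_simps)
  finally show ?case .
qed (simp_all add: algebra_simps)

lemma lucas_U_cassini:
  "(lucas_U P Q (Suc n))\<^sup>2 - lucas_U P Q (Suc (Suc n)) * lucas_U P Q n = Q ^ n"
proof (induction n)
  case (Suc n)
  have "(lucas_U P Q (Suc (Suc n)))\<^sup>2 - lucas_U P Q (Suc (Suc (Suc n))) * lucas_U P Q (Suc n)
      = Q * ((lucas_U P Q (Suc n))\<^sup>2 - lucas_U P Q (Suc (Suc n)) * lucas_U P Q n)"
    by (simp add: power2_eq_square algebra_simps)
  with Suc.IH show ?case by simp
qed simp

text \<open>Modulo p the recurrence runs backwards because Q is a unit, so two consecutive zeros
  would propagate down to \<open>U_1 = 1\<close>.\<close>

lemma not_dvd_lucas_U_Suc: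
  assumes "prime p" "\<not> p dvd Q" "p dvd lucas_U P Q n"
  shows "\<not> p dvd lucas_U P Q (Suc n)"
  using assms(3)
proof (induction n)
  case (Suc n)
  show ?case
  proof
    assume "p dvd lucas_U P Q (Suc (Suc n))"
    with Suc.prems have "p dvd P * lucas_U P Q (Suc n) - lucas_U P Q (Suc (Suc n))"
      by (intro dvd_diff dvd_mult) auto
    then have "p dvd Q * lucas_U P Q n" by simp
    with assms(1,2) have "p dvd lucas_U P Q n"
      using prime_dvd_mult_iff by blast
    with Suc show False by blast
  qed
qed (use assms(1) in auto)

text \<open>Modulo p the addition formula reduces to \<open>U_(m+n) = U_(m+1) * U_n\<close>, and
  \<open>U_(m+1)\<close> is a unit.\<close>

lemma dvd_lucas_U_diff:
  assumes "prime p" "\<not> p dvd Q" "p dvd lucas_U P Q m" "p dvd lucas_U P Q (m + n)"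
  shows "p dvd lucas_U P Q n"
proof -
  have "p dvd (lucas_U P Q (Suc m) - P * lucas_U P Q m) * lucas_U P Q n"
    using assms(3,4) unfolding lucas_U_add
    by (metis dvd_add_right_iff dvd_mult2)
  moreover have "\<not> p dvd lucas_U P Q (Suc m) - P * lucas_U P Q m"
    using not_dvd_lucas_U_Suc[OF assms(1-3)] assms(3)
    by (metis diff_add_cancel dvd_add dvd_mult)
  ultimately show ?thesis using assms(1) prime_dvd_mult_iff by blast
qed

lemma lucas_U_mult_Suc_cong:
  "[lucas_U P Q (Suc (m * q)) = lucas_U P Q (Suc m) ^ q] (mod lucas_U P Q m)"
proof (induction q)
  case (Suc q)
  have "lucas_U P Q (Suc (m * Suc q)) = lucas_U P Q (m + Suc (m * q))"
    by simp
  also have "[\<dots> = 0 + (lucas_U P Q (Suc m) - 0) * lucas_U P Q (Suc (m * q))] (mod lucas_U P Q m)"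
    unfolding lucas_U_add
    by (intro cong_add cong_mult cong_diff cong_refl) (auto simp: cong_0_iff)
  also have "[0 + (lucas_U P Q (Suc m) - 0) * lucas_U P Q (Suc (m * q))
      = lucas_U P Q (Suc m) * lucas_U P Q (Suc m) ^ q] (mod lucas_U P Q m)"
    using Suc.IH by (simp add: cong_scalar_left)
  finally show ?case by simp
qed simp

text \<open>This computes \<open>U_(mq)\<close> modulo the square of \<open>U_m\<close>, with k
  absorbing the rest. It shows how the p-adic valuation changes from \<open>U_m\<close> to
  \<open>U_(mq)\<close>: not at all if p divides \<open>U_m\<close> but neither q nor Q.\<close>

lemma lucas_U_mult_expand:
  "\<exists>k. lucas_U P Q (m * Suc q) =
     lucas_U P Q m * (int (Suc q) * lucas_U P Q (Suc m) ^ q + lucas_U P Q m * k)"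
proof (induction q)
  case 0
  show ?case by (intro exI[of _ 0]) simp
next
  case (Suc q)
  define x y where "x = lucas_U P Q m" and "y = lucas_U P Q (Suc m)"
  from Suc obtain k where
    k: "lucas_U P Q (m * Suc q) = x * (int (Suc q) * y ^ q + x * k)"
    unfolding x_def y_def by blast
  obtain j where j: "lucas_U P Q (Suc (m * Suc q)) = y ^ Suc q + x * j"
    using lucas_U_mult_Suc_cong[of P Q m "Suc q"] unfolding x_def y_def
    by (metis cong_iff_lin cong_sym)
  have "lucas_U P Q (m * Suc (Suc q)) = lucas_U P Q (m + m * Suc q)"
    by simp
  also have "\<dots> = x * (y ^ Suc q + x * j) + (y - P * x) * (x * (int (Suc q) * y ^ q + x * k))"
    unfolding lucas_U_add j k by (simp add: x_def y_def)
  also have "\<dots> = x * (int (Suc (Suc q)) * y ^ Suc q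
      + x * (j + y * k - P * (int (Suc q) * y ^ q + x * k)))"
    by (simp add: algebra_simps)
  finally show ?case unfolding x_def y_def by blast
qed

lemma lucas_U_dvd_mult: "lucas_U P Q m dvd lucas_U P Q (m * q)"
proof (cases q)
  case (Suc n)
  then show ?thesis using lucas_U_mult_expand[of P Q m n] by auto
qed simp

text \<open>Passing from index n to \<open>n * p\<close> gains a factor p: in the expansion one
  summand of the cofactor carries p itself, the other carries \<open>U_n\<close>.\<close>

lemma prime_power_dvd_lucas_U:
  assumes "prime p" "int p dvd lucas_U P Q r" "r \<ge> 1"
  shows "\<exists>n\<ge>1. int p ^ Suc e dvd lucas_U P Q n"
proof (induction e)
  case 0
  show ?case using assms by auto
next
  case (Suc e)
  then obtain n where n: "n \<ge> 1" "int p ^ Suc e dvd lucas_U P Q n" by blast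
  have "int p dvd lucas_U P Q n"
    using n(2) dvd_trans[of "int p" "int p ^ Suc e"] by simp
  obtain q where q: "p = Suc q" using assms(1) by (metis not0_implies_Suc not_prime_0)
  obtain k where k: "lucas_U P Q (n * p) =
      lucas_U P Q n * (int p * lucas_U P Q (Suc n) ^ q + lucas_U P Q n * k)"
    using lucas_U_mult_expand[of P Q n q] q by auto
  have "int p ^ Suc e * int p dvd lucas_U P Q (n * p)"
    unfolding k using n(2) \<open>int p dvd lucas_U P Q n\<close> by (intro mult_dvd_mono dvd_add) auto
  then have "int p ^ Suc (Suc e) dvd lucas_U P Q (n * p)"
    by (simp add: mult.commute)
  moreover have "n * p \<ge> 1" using n(1) q by simp
  ultimately show ?case by blast
qed

section \<open>The rank of appearance\<close>

text \<open>Binet's formula for the roots \<open>(P + s) / 2\<close> and \<open>(P - s) / 2\<close>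
  of \<open>x^2 - P x + Q\<close>, scaled by \<open>2 ^ n\<close> to clear denominators.\<close>

lemma lucas_U_binet:
  fixes s :: complex
  assumes "s\<^sup>2 = of_int (lucas_disc P Q)"
  shows "(of_int P + s) ^ n - (of_int P - s) ^ n = s * 2 ^ n * of_int (lucas_U P Q n)"
proof (induction n rule: induct_nat_012)
  case (ge2 n)
  let ?x = "of_int P + s" and ?y = "of_int P - s"
  have s: "s * s = of_int P * of_int P - 4 * of_int Q"
    using assms by (simp add: lucas_disc_def power2_eq_square)
  have "?x * ?x = 2 * of_int P * ?x - 4 * of_int Q" "?y * ?y = 2 * of_int P * ?y - 4 * of_int Q"
    using s by (simp_all add: algebra_simps)
  then have "?x ^ Suc (Suc n) - ?y ^ Suc (Suc n) =
      (2 * of_int P * ?x - 4 * of_int Q) * ?x ^ n - (2 * of_int P * ?y - 4 * of_int Q) * ?y ^ n"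
    by (metis mult.assoc power_Suc)
  also have "\<dots> = 2 * of_int P * (?x ^ Suc n - ?y ^ Suc n) - 4 * of_int Q * (?x ^ n - ?y ^ n)"
    by (simp add: algebra_simps)
  also have "\<dots> = s * 2 ^ Suc (Suc n) * of_int (lucas_U P Q (Suc (Suc n)))"
    unfolding ge2.IH by (simp add: algebra_simps)
  finally show ?case .
qed simp_all

text \<open>Expanding both powers in Binet's formula, the even powers of s cancel and the odd ones
  double; dividing by the nonzero s leaves integers.\<close>

lemma lucas_U_binomial:
  assumes "lucas_disc P Q \<noteq> 0"
  shows "2 ^ n * lucas_U P Q n =
    2 * (\<Sum>j\<le>n. int (n choose j) * (if odd j then lucas_disc P Q ^ (j div 2) else 0) * P ^ (n - j))"
    (is "_ = 2 * (\<Sum>j\<le>n. int (n choose j) * ?t j * _)")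
proof -
  define s :: complex where "s = csqrt (of_int (lucas_disc P Q))"
  have s: "s\<^sup>2 = of_int (lucas_disc P Q)" by (simp add: s_def)
  then have "s \<noteq> 0" using assms by auto
  have t: "s ^ j - (- s) ^ j = 2 * s * of_int (?t j)" for j
  proof (cases "odd j")
    case True
    then obtain i where "j = Suc (2 * i)" by (metis oddE Suc_eq_plus1)
    then show ?thesis by (simp add: power_mult s)
  qed simp
  have "s * (2 ^ n * of_int (lucas_U P Q n)) = (s + of_int P) ^ n - (- s + of_int P) ^ n"
    using lucas_U_binet[OF s, of n] by (simp add: add.commute)
  also have "\<dots> = (\<Sum>j\<le>n. of_nat (n choose j) * (s ^ j - (- s) ^ j) * of_int P ^ (n - j))"
    unfolding binomial_ring by (simp add: sum_subtractf algebra_simps)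
  also have "\<dots> = s * (2 * of_int (\<Sum>j\<le>n. int (n choose j) * ?t j * P ^ (n - j)))"
    unfolding t by (simp add: sum_distrib_left mult_ac)
  finally have "2 ^ n * of_int (lucas_U P Q n) =
      (2 * of_int (\<Sum>j\<le>n. int (n choose j) * ?t j * P ^ (n - j)) :: complex)"
    using \<open>s \<noteq> 0\<close> by simp
  then have "(of_int (2 ^ n * lucas_U P Q n) :: complex) =
      of_int (2 * (\<Sum>j\<le>n. int (n choose j) * ?t j * P ^ (n - j)))"
    by (simp only: of_int_mult of_int_power of_int_numeral)
  then show ?thesis by (simp only: of_int_eq_iff)
qed

lemma fermat_theorem_int:
  assumes "prime p" "\<not> int p dvd a"
  shows "[a ^ (p - 1) = 1] (mod int p)"
proof -
  interpret residues "int p" "residue_ring (int p)"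
    by unfold_locales (use assms(1) prime_gt_1_nat in auto)
  have "coprime a (int p)"
    using assms prime_imp_coprime[of "int p" a] by (simp add: coprime_commute)
  from euler_theorem[OF this] show ?thesis
    using assms(1) by (simp add: totient_prime)
qed

text \<open>At \<open>n = p\<close> every binomial term below the top one vanishes modulo p, so
  \<open>U_p\<close> is congruent to \<open>D^((p-1)/2)\<close>, where D is the discriminant.
  Squaring turns this into Fermat's theorem and avoids the Legendre symbol.\<close>

lemma lucas_U_prime_square_cong:
  assumes "prime p" "odd p" "\<not> int p dvd lucas_disc P Q"
  shows "[(lucas_U P Q p)\<^sup>2 = 1] (mod int p)"
proof -
  let ?D = "lucas_disc P Q"
  let ?f = "\<lambda>j. int (p choose j) * (if odd j then ?D ^ (j div 2) else 0) * P ^ (p - j)"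
  have p0: "p > 0" using assms(1) prime_gt_0_nat by blast
  have D: "?D \<noteq> 0" using assms(3) by auto
  have "2 * 2 ^ (p - 1) * lucas_U P Q p = 2 * (\<Sum>j\<le>p. ?f j)"
    using lucas_U_binomial[OF D, of p] p0 by (metis power_minus_mult mult.commute)
  then have "2 ^ (p - 1) * lucas_U P Q p = (\<Sum>j\<le>p. ?f j)" by simp
  also have "\<dots> = (\<Sum>j<p. ?f j) + ?D ^ (p div 2)"
    using assms(2) by (simp add: lessThan_Suc_atMost[symmetric])
  also have "[\<dots> = 0 + ?D ^ (p div 2)] (mod int p)"
  proof (intro cong_add cong_refl)
    have "int p dvd ?f j" if "j < p" for j
    proof (cases "j = 0")
      case False
      then have "p dvd (p choose j)" using that assms(1) p0 by (intro dvd_choose_prime) auto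
      then show ?thesis by (simp add: dvd_mult2)
    qed simp
    then show "[(\<Sum>j<p. ?f j) = 0] (mod int p)" by (auto simp: cong_0_iff intro!: dvd_sum)
  qed
  finally have "[(2 ^ (p - 1) * lucas_U P Q p)\<^sup>2 = (?D ^ (p div 2))\<^sup>2] (mod int p)"
    by (simp add: cong_pow)
  moreover have "(?D ^ (p div 2))\<^sup>2 = ?D ^ (p - 1)"
    using assms(2) by (auto elim!: oddE simp: mult.commute simp flip: power_mult)
  moreover have "[?D ^ (p - 1) = 1] (mod int p)"
    by (rule fermat_theorem_int) fact+
  moreover have "[(2 ^ (p - 1) * lucas_U P Q p)\<^sup>2 = (1 * lucas_U P Q p)\<^sup>2] (mod int p)"
  proof (intro cong_pow cong_mult cong_refl fermat_theorem_int)
    have "\<not> p dvd 2"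
      using assms(1,2) by (metis primes_dvd_imp_eq two_is_prime_nat even_numeral)
    then show "\<not> int p dvd 2"
      by (metis int_dvd_int_iff of_nat_numeral)
  qed fact
  ultimately show ?thesis by (metis cong_sym cong_trans mult_1)
qed

lemma lucas_rank_SomeD:
  assumes "prime p" "\<not> int p dvd lucas_disc P Q * Q" "lucas_rank P Q p = Some r"
  shows "r \<ge> 1" "int p dvd lucas_U P Q r" "r \<noteq> p" "r \<le> p + 1"
proof -
  have pD: "\<not> int p dvd lucas_disc P Q" and pQ: "\<not> int p dvd Q"
    using assms(2) by auto
  have p2: "p \<ge> 2" using assms(1) prime_ge_2_nat by blast
  have r: "r = (LEAST n. n \<ge> 1 \<and> int p dvd lucas_U P Q n)"
    using assms(3) pQ by (simp add: lucas_rank_def)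
  have "\<not> int p dvd lucas_U P Q p \<and> (\<exists>n. n \<ge> 1 \<and> n \<le> p + 1 \<and> int p dvd lucas_U P Q n)"
  proof (cases "odd p")
    case False
    \<comment> \<open>For \<open>p = 2\<close> both P and Q are odd, so \<open>U_2 = P\<close> is
      odd and \<open>U_3 = P^2 - Q\<close> is even.\<close>
    then have "p = 2" using assms(1) primes_dvd_imp_eq two_is_prime_nat by blast
    with pD pQ have "odd P" "odd Q" by (auto simp: lucas_disc_def)
    with \<open>p = 2\<close> show ?thesis
      by (auto intro!: exI[of _ 3] simp: numeral_2_eq_2 numeral_3_eq_3)
  next
    case True
    have sq: "[(lucas_U P Q p)\<^sup>2 = 1] (mod int p)"
      by (rule lucas_U_prime_square_cong) fact+
    have "\<not> int p dvd lucas_U P Q p"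
    proof
      assume "int p dvd lucas_U P Q p"
      then have "int p dvd (lucas_U P Q p)\<^sup>2" by (simp add: power2_eq_square)
      with sq have "int p dvd 1" by (metis cong_dvd_iff)
      with p2 show False by simp
    qed
    moreover have "int p dvd lucas_U P Q (p + 1) * lucas_U P Q (p - 1)"
    proof -
      \<comment> \<open>Both \<open>U_p^2\<close> and \<open>Q^(p-1)\<close> are 1 modulo p, so
        Cassini's identity puts a zero at index \<open>p - 1\<close> or
        \<open>p + 1\<close>.\<close>
      have "lucas_U P Q (p + 1) * lucas_U P Q (p - 1) = (lucas_U P Q p)\<^sup>2 - Q ^ (p - 1)"
        using lucas_U_cassini[of P Q "p - 1"] p2 by simp
      also have "[\<dots> = 1 - 1] (mod int p)"
        by (intro cong_diff sq fermat_theorem_int) fact+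
      finally show ?thesis by (simp add: cong_0_iff)
    qed
    then have "int p dvd lucas_U P Q (p + 1) \<or> int p dvd lucas_U P Q (p - 1)"
      using assms(1) prime_dvd_mult_iff prime_int_nat_transfer by (metis nat_int of_nat_0_le_iff)
    then have "\<exists>n. n \<ge> 1 \<and> n \<le> p + 1 \<and> int p dvd lucas_U P Q n"
      using p2 by (auto intro: exI[of _ "p + 1"] exI[of _ "p - 1"])
    ultimately show ?thesis by blast
  qed
  then obtain n where n: "n \<ge> 1 \<and> int p dvd lucas_U P Q n" "n \<le> p + 1"
    and p: "\<not> int p dvd lucas_U P Q p" by blast
  from LeastI[of "\<lambda>n. n \<ge> 1 \<and> int p dvd lucas_U P Q n", OF n(1)]
  show "r \<ge> 1" and r': "int p dvd lucas_U P Q r" unfolding r by auto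
  show "r \<noteq> p" using r' p by blast
  show "r \<le> p + 1"
    using Least_le[of "\<lambda>n. n \<ge> 1 \<and> int p dvd lucas_U P Q n", OF n(1)] n(2) unfolding r by linarith
qed

section \<open>Non-integrality of the multi-Catalan quotients\<close>

text \<open>The ultrametric equality: y has strictly larger valuation than x, and the unit c does
  not change that of x.\<close>

lemma multiplicity_mult_add_eq:
  fixes p :: int
  assumes "prime p" "\<not> p dvd c" "\<not> p ^ e dvd x" "p ^ e dvd y"
  shows "multiplicity p (c * x + y) = multiplicity p x"
proof (rule multiplicity_eqI)
  let ?m = "multiplicity p x"
  have m: "p ^ Suc ?m dvd y"
    using assms(3,4) multiplicity_dvd'[of e p x]
    by (meson dvd_trans le_imp_power_dvd not_less_eq_eq)
  show "p ^ ?m dvd c * x + y"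
    using m by (meson dvd_add dvd_mult dvd_trans le_imp_power_dvd le_SucI le_refl multiplicity_dvd)
  have "x \<noteq> 0" using assms(3) by auto
  show "\<not> p ^ Suc ?m dvd c * x + y"
  proof
    assume "p ^ Suc ?m dvd c * x + y"
    with m have "p ^ Suc ?m dvd c * x" by (metis dvd_add_left_iff)
    then have "Suc ?m \<le> multiplicity p (c * x)"
      using \<open>x \<noteq> 0\<close> assms(1,2) by (intro multiplicity_geI) auto
    also have "\<dots> = ?m"
      using assms(1,2) by (intro multiplicity_prime_elem_times_other) auto
    finally show False by simp
  qed
qed

text \<open>Here f stands for the valuation of \<open>U_i\<close>. The bound L is present because
  \<open>mult\<close> will only be available for multipliers below p.\<close>

lemma sum_blocks:
  fixes f :: "nat \<Rightarrow> nat"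
  assumes shift: "\<And>q s. q \<le> L \<Longrightarrow> 0 < s \<Longrightarrow> s < M \<Longrightarrow> f (M * q + s) = f s"
    and mult: "\<And>q. 1 \<le> q \<Longrightarrow> q \<le> L \<Longrightarrow> f (M * q) = f M"
    and "M \<ge> 1"
  shows "q \<le> L \<Longrightarrow> t < M \<Longrightarrow>
    (\<Sum>i=1..M * q + t. f i) = q * ((\<Sum>i=1..M - 1. f i) + f M) + (\<Sum>i=1..t. f i)"
proof (induction q arbitrary: t)
  case (Suc q)
  show ?case using Suc.prems(2)
  proof (induction t)
    case 0
    have "M * Suc q = Suc (M * q + (M - 1))" using \<open>M \<ge> 1\<close> by (simp add: algebra_simps)
    moreover have "(\<Sum>i=1..Suc k. f i) = (\<Sum>i=1..k. f i) + f (Suc k)" for k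
      by simp
    ultimately have "(\<Sum>i=1..M * Suc q + 0. f i) = (\<Sum>i=1..M * q + (M - 1). f i) + f (M * Suc q)"
      by (simp only: add_0_right)
    also have "f (M * Suc q) = f M" using Suc.prems by (intro mult) auto
    also have "(\<Sum>i=1..M * q + (M - 1). f i)
        = q * ((\<Sum>i=1..M - 1. f i) + f M) + (\<Sum>i=1..M - 1. f i)"
      using Suc.prems \<open>M \<ge> 1\<close> by (intro Suc.IH) auto
    finally show ?case by simp
  next
    case (Suc t)
    have "f (M * Suc q + Suc t) = f (Suc t)"
      using \<open>Suc q \<le> L\<close> Suc.prems by (intro shift) auto
    with Suc show ?case by simp
  qed
qed simp

lemma not_multi_catalan:
  assumes nz: "\<And>n. n \<ge> 1 \<Longrightarrow> lucas_U P Q n \<noteq> 0"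
    and p: "prime p" "\<not> int p dvd Q"
    and r: "r \<ge> 1" "int p dvd lucas_U P Q r"
    and L: "r \<le> L" "L < p"
  shows "\<not> multi_catalan P Q L"
proof
  assume "multi_catalan P Q L"
  then obtain N where N: "\<And>n. n \<ge> 1 \<Longrightarrow> lucas_catalan P Q L n \<notin> \<int> \<Longrightarrow> n \<le> N"
    unfolding multi_catalan_def finite_nat_set_iff_bounded_le by blast
  let ?U = "lucas_U P Q"
  have ip: "prime (int p)" using p(1) by simp
  define f where "f i = multiplicity (int p) (?U i)" for i
  \<comment> \<open>This e bounds each of the first \<open>N + L + 1\<close> valuations, so an index
    M with \<open>p^(e+1)\<close> dividing \<open>U_M\<close> lies beyond them; then
    \<open>n = M - 1\<close> exceeds both N and L.\<close>
  define e where "e = (\<Sum>i=1..N + L + 1. f i)"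
  define M where "M = (LEAST n. n \<ge> 1 \<and> int p ^ Suc e dvd ?U n)"
  have "\<exists>n. n \<ge> 1 \<and> int p ^ Suc e dvd ?U n"
    using prime_power_dvd_lucas_U[OF p(1) r(2) r(1)] by blast
  from LeastI_ex[OF this] have M: "M \<ge> 1" "int p ^ Suc e dvd ?U M"
    unfolding M_def by auto
  have small: "\<not> int p ^ Suc e dvd ?U s" if "0 < s" "s < M" for s
    using not_less_Least[of s "\<lambda>n. n \<ge> 1 \<and> int p ^ Suc e dvd ?U n"] that
    unfolding M_def by auto
  have "M > N + L + 1"
  proof (rule ccontr)
    assume "\<not> M > N + L + 1"
    then have "f M \<le> e" unfolding e_def using M(1) by (intro member_le_sum) auto
    moreover have "Suc e \<le> f M"
      unfolding f_def using M nz[of M] ip by (intro multiplicity_geI) auto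
    ultimately show False by simp
  qed
  have pM: "int p dvd ?U M"
    using M(2) dvd_trans[of "int p" "int p ^ Suc e"] by simp

  have shift: "f (M * q + s) = f s" if "0 < s" "s < M" for q s
  proof -
    have d: "?U M dvd ?U (M * q)" by (rule lucas_U_dvd_mult)
    have pd: "int p dvd ?U (M * q)" using pM d by (rule dvd_trans)
    have "?U (M * q + s) = (?U (Suc (M * q)) - P * ?U (M * q)) * ?U s + ?U (M * q) * ?U (Suc s)"
      unfolding lucas_U_add by simp
    moreover have "\<not> int p dvd ?U (Suc (M * q)) - P * ?U (M * q)"
      using not_dvd_lucas_U_Suc[OF ip p(2) pd] pd by (metis diff_add_cancel dvd_add dvd_mult)
    moreover have "int p ^ Suc e dvd ?U (M * q) * ?U (Suc s)"
      using M(2) d by (meson dvd_mult2 dvd_trans)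
    ultimately show ?thesis
      unfolding f_def using multiplicity_mult_add_eq[OF ip _ small[OF that]] by simp
  qed
  have mult: "f (M * q) = f M" if "1 \<le> q" "q \<le> L" for q
  proof -
    obtain q' where q': "q = Suc q'" using \<open>1 \<le> q\<close> by (cases q) auto
    \<comment> \<open>The cofactor of \<open>U_M\<close> is prime to p since
      \<open>0 < q < p\<close> and p does not divide \<open>U_(M+1)\<close>.\<close>
    obtain k where k: "?U (M * q) = ?U M * (int q * ?U (Suc M) ^ q' + ?U M * k)"
      using lucas_U_mult_expand[of P Q M q'] q' by auto
    have "\<not> int p dvd int q * ?U (Suc M) ^ q' + ?U M * k"
    proof
      assume "int p dvd int q * ?U (Suc M) ^ q' + ?U M * k"
      then have "int p dvd int q * ?U (Suc M) ^ q'"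
        using pM by (metis dvd_add_left_iff dvd_mult2)
      then have "int p dvd int q \<or> int p dvd ?U (Suc M)"
        using ip by (meson prime_dvd_mult_iff prime_dvd_power)
      moreover have "\<not> int p dvd int q"
        using that L(2) by (auto dest: dvd_imp_le)
      ultimately show False using not_dvd_lucas_U_Suc[OF ip p(2) pM] by blast
    qed
    then show ?thesis
      unfolding f_def k using ip
      by (subst mult.commute) (intro multiplicity_prime_elem_times_other, auto)
  qed

  define n where "n = M - 1"
  have n: "n \<ge> 1" "n > N" "n + 1 = M" using \<open>M > N + L + 1\<close> by (auto simp: n_def)
  have fact_nz: "lucas_fact P Q k \<noteq> 0" for k
    using nz by (auto simp: lucas_fact_def)
  have v_fact: "multiplicity (int p) (lucas_fact P Q k) = (\<Sum>i=1..k. f i)" for k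
    unfolding lucas_fact_def f_def using ip nz
    by (intro prime_elem_multiplicity_prod_distrib) force+

  have "lucas_catalan P Q L n \<in> \<int>" using N[of n] n by force
  then obtain z where z: "lucas_catalan P Q L n = of_int z" by (auto elim: Ints_cases)
  have UM: "?U M \<noteq> 0" using nz M(1) by blast
  \<comment> \<open>Clearing denominators turns integrality into a divisibility of integers, hence
    into an inequality of valuations.\<close>
  have "(of_int (lucas_fact P Q ((L + 1) * n)) :: rat) =
      of_int z * (of_int (?U M) ^ L * of_int (lucas_fact P Q n) ^ (L + 1))"
    unfolding z[symmetric] lucas_catalan_def n(3) using UM fact_nz[of n] by simp
  then have "(of_int (lucas_fact P Q ((L + 1) * n)) :: rat) =
      of_int (z * (?U M ^ L * lucas_fact P Q n ^ (L + 1)))"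
    by (simp only: of_int_mult of_int_power)
  then have "lucas_fact P Q ((L + 1) * n) = z * (?U M ^ L * lucas_fact P Q n ^ (L + 1))"
    by (simp only: of_int_eq_iff)
  then have "multiplicity (int p) (?U M ^ L * lucas_fact P Q n ^ (L + 1))
      \<le> multiplicity (int p) (lucas_fact P Q ((L + 1) * n))"
    using fact_nz by (intro dvd_imp_multiplicity_le) (metis dvd_triv_right)+
  moreover have "multiplicity (int p) (?U M ^ L * lucas_fact P Q n ^ (L + 1))
      = L * f M + (L + 1) * (\<Sum>i=1..n. f i)"
    unfolding v_fact[symmetric] f_def[of M] using UM fact_nz[of n] ip
    by (simp add: prime_elem_multiplicity_power_distrib prime_elem_multiplicity_mult_distrib)
  ultimately have le: "L * f M + (L + 1) * (\<Sum>i=1..n. f i) \<le> (\<Sum>i=1..(L + 1) * n. f i)"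
    by (simp only: v_fact)
  \<comment> \<open>Since \<open>n = M - 1\<close>, this is L complete blocks and a remainder of
    length \<open>n - L\<close>. In \<open>le\<close> the complete blocks cancel, leaving a full sum
    up to n against a truncated one.\<close>
  have "(L + 1) * n = M * L + (n - L)"
    using \<open>M > N + L + 1\<close> n(3) by (auto simp: algebra_simps simp flip: n(3))
  then have "(\<Sum>i=1..(L + 1) * n. f i) = L * ((\<Sum>i=1..n. f i) + f M) + (\<Sum>i=1..n - L. f i)"
    using sum_blocks[of L M f L "n - L"] shift mult M(1) n(3) by (simp add: n_def)
  with le have "(\<Sum>i=1..n. f i) \<le> (\<Sum>i=1..n - L. f i)"
    by (simp add: algebra_simps)
  moreover
  \<comment> \<open>The index \<open>M - r\<close> lies in the gap between \<open>n - L\<close> and \<open>n\<close>, and \<open>p\<close> divides \<open>U\<close> there.\<close>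
  have "(\<Sum>i=1..n - L. f i) + f (M - r) \<le> (\<Sum>i=1..n. f i)"
  proof -
    have "(\<Sum>i=1..n - L. f i) + f (M - r) = (\<Sum>i\<in>insert (M - r) {1..n - L}. f i)"
      using L(1) n(3) \<open>M > N + L + 1\<close> by (subst sum.insert) auto
    also have "\<dots> \<le> (\<Sum>i=1..n. f i)"
      using L(1) r(1) n(3) \<open>M > N + L + 1\<close> by (intro sum_mono2) auto
    finally show ?thesis .
  qed
  moreover have "f (M - r) > 0"
  proof -
    have "M - r \<ge> 1" "r + (M - r) = M" using L(1) \<open>M > N + L + 1\<close> by auto
    then have "int p dvd ?U (M - r)"
      using dvd_lucas_U_diff[OF ip p(2) r(2), of "M - r"] pM by simp
    then show ?thesis
      unfolding f_def using nz[OF \<open>M - r \<ge> 1\<close>] ip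
      by (subst multiplicity_gt_zero_iff) auto
  qed
  ultimately show False by linarith
qed

theorem theorem22:
  fixes P Q :: int and l :: nat
  assumes "P \<noteq> 0" and "Q \<noteq> 0"
    and "l \<ge> 2"
    and "disc_regular P Q"
    and "multi_catalan P Q l"
  shows "(\<not> prime (l - 1) \<or> (prime (l - 1) \<and> lucas_rank P Q (l - 1) \<noteq> Some l)
            \<longrightarrow> defective P Q l) \<and>
         (prime (l - 1) \<and> l - 1 > 3 \<and> \<not> int (l - 1) dvd Q \<and> lucas_rank P Q (l - 1) = Some l
            \<longrightarrow> defective P Q (l - 1))"
proof -
  have nz: "lucas_U P Q n \<noteq> 0" if "n \<ge> 1" for n
    using assms(4) that by (auto simp: disc_regular_def)
  \<comment> \<open>A larger prime of rank at most l would make infinitely many quotients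
    non-integral.\<close>
  have p_le: "p \<le> l"
    if "prime p" "\<not> int p dvd lucas_disc P Q * Q" "lucas_rank P Q p = Some r" "r \<le> l" for p r
    using not_multi_catalan[OF nz that(1), of r l] lucas_rank_SomeD[OF that(1-3)] that assms(5)
    by (meson dvd_mult not_less)
  show ?thesis
  proof (intro conjI impI)
    assume *: "\<not> prime (l - 1) \<or> (prime (l - 1) \<and> lucas_rank P Q (l - 1) \<noteq> Some l)"
    show "defective P Q l"
      unfolding defective_def
    proof safe
      fix p assume p: "prime p" "\<not> int p dvd lucas_disc P Q * Q" "lucas_rank P Q p = Some l"
      have "p \<le> l" using p_le[OF p] by simp
      \<comment> \<open>The rank l differs from p and is at most \<open>p + 1\<close>, while
        \<open>p \<le> l\<close>.\<close>
      with lucas_rank_SomeD[OF p] have "p = l - 1" by linarith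
      with p * show False by auto
    qed
  next
    assume *: "prime (l - 1) \<and> l - 1 > 3 \<and> \<not> int (l - 1) dvd Q \<and> lucas_rank P Q (l - 1) = Some l"
    show "defective P Q (l - 1)"
      unfolding defective_def
    proof safe
      fix p assume p: "prime p" "\<not> int p dvd lucas_disc P Q * Q" "lucas_rank P Q p = Some (l - 1)"
      have "p \<le> l" using p_le[OF p] by simp
      \<comment> \<open>Now \<open>l - 1\<close> is the rank, so p is one of its two neighbours. As
        \<open>l - 1\<close> is an odd prime, p is even, and \<open>p = 2\<close> contradicts
        \<open>l - 1 > 3\<close>.\<close>
      with lucas_rank_SomeD[OF p] have "p = l - 2 \<or> p = l" by linarith
      moreover have "odd (l - 1)" using * prime_odd_nat[of "l - 1"] by linarith
      ultimately have "even p" using assms(3) by auto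
      with p(1) have "p = 2" using primes_dvd_imp_eq two_is_prime_nat by blast
      with \<open>p = l - 2 \<or> p = l\<close> * show False by auto
    qed
  qed
qed

end
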